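(* Let $f:\mathcal X\to\mathbb R^k$ be a function with $P_0f^2<\infty$, and write $od(p)=(1-p)/p$. Let $$Y_f\equiv f(X)I\{V\in\mathcal V^{(1)}\cap\{\mathcal V^{(2)}\}^c\},\qquad Z_f\equiv f(X)I\{V\in\mathcal V^{(1)}\cap\mathcal V^{(2)}\},$$ and define $$c_f\equiv\frac{-\nu^{(1)}od(p^{(1)})\,P_0^{(1)}Y_f\,P_0^{(1)}Z_f+\nu^{(2)}od(p^{(2)})\left\{P_0^{(2)}Y_f\,P_0^{(2)}Z_f-\mathrm{Var}_0^{(2)}(Z_f)\right\}}{\nu^{(1)}od(p^{(1)})\mathrm{Var}_0^{(1)}(Z_f)+\nu^{(2)}od(p^{(2)})\mathrm{Var}_0^{(2)}(Z_f)}.$$ When $J=2$, the optimal weight function $\rho$ that minimizes the asymptotic variance of $\mathbb G_N^{\mathrm H}f$ (under sampling without replacement) has $c^{(1)}=0\vee c_f\wedge 1$ (that is, $c_f$ truncated to $[0,1]$) and $c^{(2)}=1-c^{(1)}$.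
   Context: Setting ($J=2$ data sources). $X$ takes values in a measurable space $(\mathcal{X},\mathcal{A})$ and has law $P_0$. $U\in\mathcal U$ is a vector of auxiliary variables, $W=(X,U)\in\mathcal W=\mathcal X\times\mathcal U$ has law $\tilde P_0$, and $V=(\check X,U)\in\mathcal V$, where $\check X$ is a coarsening of $X$. The space $\mathcal V=\mathcal V^{(1)}\cup\mathcal V^{(2)}$ is a union of two overlapping data sources. $\nu^{(j)}=\tilde P_0(V\in\mathcal V^{(j)})$, $P_0^{(j)}$ is the conditional law of $W$ given $V\in\mathcal V^{(j)}$, and $\mathrm{Var}_0$, $\mathrm{Var}_0^{(j)}$ are variances under $P_0$, $P_0^{(j)}$; $P_0^{(j)}Y$ denotes the expectation of $Y$ under $P_0^{(j)}$. Sampling. $W_1,\dots,W_N$ are i.i.d. copies of $W$ with corresponding $X_i,V_i$; $N^{(j)}=\#\{i\le N:V_i\in\mathcal V^{(j)}\}$. From each source $j$ a simple random sample of size $n^{(j)}\le N^{(j)}$ is drawn without replacement from the units with $V_i\in\mathcal V^{(j)}$, independently across sources given the data; $R_i^{(j)}\in\{0,1\}$ is the selection indicator ($0$ if $V_i\notin\mathcal V^{(j)}$); $\pi^{(j)}(V_i)=(n^{(j)}/N^{(j)})I\{V_i\in\mathcal V^{(j)}\}$, with convention $0/0=0$; $n^{(j)}/N^{(j)}\to p^{(j)}\ge c>0$ as $N\to\infty$ for some constant $c$. Weight functions. The minimization is over $\rho=(\rho^{(1)},\rho^{(2)})$ with $\rho(v)=(1,0)$ if $v\in\mathcal V^{(1)}$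 and $v\notin\mathcal V^{(2)}$, $\rho(v)=(0,1)$ if $v\notin\mathcal V^{(1)}$ and $v\in\mathcal V^{(2)}$, and $\rho(v)=(c^{(1)},c^{(2)})$ if $v\in\mathcal V^{(1)}\cap\mathcal V^{(2)}$, where $c^{(1)},c^{(2)}\in[0,1]$ are constants with $c^{(1)}+c^{(2)}=1$. $\mathbb G_N^{\mathrm H}f=\sqrt N\Big(\frac1N\sum_{i=1}^N\sum_{j=1}^2\frac{R_i^{(j)}\rho^{(j)}(V_i)}{\pi^{(j)}(V_i)}f(X_i)-P_0f\Big)$; its asymptotic variance is $\mathrm{Var}_0\{f(X)\}+\sum_{j=1}^2\nu^{(j)}\frac{1-p^{(j)}}{p^{(j)}}\mathrm{Var}_0^{(j)}\{\rho^{(j)}(V)f(X)\}$.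
   Formalization: The printed c_f is not optimal: its numerator has the wrong overall sign, and Y_f in the second source must be f(X)I{V in V^(2), not in V^(1)}; the corrected c_f is used. For k>1, variance means the trace of the covariance matrix and products of means are inner products. *)

theory Defs
  imports "HOL-Probability.Probability"
begin

text \<open>
  Throughout, \<open>P\<close> is the law of \<open>W = (X, U)\<close>, a measure on pairs, so that \<open>X = fst\<close> and the law
  of \<open>X\<close> is \<open>distr P MX fst\<close>.  The coarsening of \<open>X\<close> is \<open>chk X\<close>, and a data source is a set of
  values of \<open>V = (chk X, U)\<close>.
\<close>

definition Vobs :: "('x \<Rightarrow> 'c) \<Rightarrow> 'x \<times> 'u \<Rightarrow> 'c \<times> 'u" where
  "Vobs chk w = (chk (fst w), snd w)"

definition in_source :: "('x \<times> 'u) measure \<Rightarrow> ('x \<Rightarrow> 'c) \<Rightarrow> ('c \<times> 'u) set \<Rightarrow> ('x \<times> 'u) set" where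
  "in_source P chk S = {w \<in> space P. Vobs chk w \<in> S}"

definition source_prob :: "('x \<times> 'u) measure \<Rightarrow> ('x \<Rightarrow> 'c) \<Rightarrow> ('c \<times> 'u) set \<Rightarrow> real" where
  "source_prob P chk S = measure P (in_source P chk S)"

definition source_law ::
    "('x \<times> 'u) measure \<Rightarrow> ('x \<Rightarrow> 'c) \<Rightarrow> ('c \<times> 'u) set \<Rightarrow> ('x \<times> 'u) measure" where
  "source_law P chk S = uniform_measure P (in_source P chk S)"

text \<open>
  For \<open>Y\<close> with values in a \<open>k\<close>-dimensional space this is the trace of the covariance matrix
  (total variance), which makes minimization of a variance meaningful for every \<open>k\<close>;
  for \<open>k = 1\<close> it is the usual variance.
\<close>

definition Var :: "'a measure \<Rightarrow> ('a \<Rightarrow> 'b::euclidean_space) \<Rightarrow> real" where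
  "Var Q Y = (\<integral>w. (norm (Y w - (\<integral>w'. Y w' \<partial>Q)))\<^sup>2 \<partial>Q)"

definition od :: "real \<Rightarrow> real" where
  "od p = (1 - p) / p"

definition weight_functions :: "'v set \<Rightarrow> 'v set \<Rightarrow> ('v \<Rightarrow> real \<times> real) set" where
  "weight_functions S1 S2 = {\<rho>. \<exists>c1 c2. c1 \<in> {0..1} \<and> c2 \<in> {0..1} \<and> c1 + c2 = 1 \<and>
     (\<forall>v \<in> S1 - S2. \<rho> v = (1, 0)) \<and>
     (\<forall>v \<in> S2 - S1. \<rho> v = (0, 1)) \<and>
     (\<forall>v \<in> S1 \<inter> S2. \<rho> v = (c1, c2))}"

definition weight_with :: "'v set \<Rightarrow> 'v set \<Rightarrow> real \<Rightarrow> real \<Rightarrow> 'v \<Rightarrow> real \<times> real" where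
  "weight_with S1 S2 c1 c2 v =
     (if v \<in> S1 \<inter> S2 then (c1, c2) else if v \<in> S1 then (1, 0) else (0, 1))"

text \<open>
  The asymptotic variance of
  \<open>sqrt N * (1/N * (\<Sum>i=1..N. \<Sum>j=1..2. R\<^sub>i\<^sub>j * \<rho>\<^sub>j V\<^sub>i / \<pi>\<^sub>j V\<^sub>i * f X\<^sub>i) - E (f X))\<close>,
  where \<open>n\<^sub>j\<close> of the \<open>N\<^sub>j\<close> units in source \<open>j\<close> are drawn without replacement, independently across
  sources, \<open>\<pi>\<^sub>j V\<^sub>i\<close> is \<open>n\<^sub>j / N\<^sub>j\<close> on source \<open>j\<close> and \<open>0\<close> off it, and \<open>p\<^sub>j\<close> is the limit
  of \<open>n\<^sub>j / N\<^sub>j\<close>.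
\<close>

definition asymp_var ::
    "'x measure \<Rightarrow> ('x \<times> 'u) measure \<Rightarrow> ('x \<Rightarrow> 'c) \<Rightarrow> ('c \<times> 'u) set \<Rightarrow> ('c \<times> 'u) set \<Rightarrow>
     real \<Rightarrow> real \<Rightarrow> ('x \<Rightarrow> 'b::euclidean_space) \<Rightarrow> ('c \<times> 'u \<Rightarrow> real \<times> real) \<Rightarrow> real" where
  "asymp_var MX P chk S1 S2 p1 p2 f \<rho> =
     Var (distr P MX fst) f
     + source_prob P chk S1 * ((1 - p1) / p1) *
         Var (source_law P chk S1) (\<lambda>w. fst (\<rho> (Vobs chk w)) *\<^sub>R f (fst w))
     + source_prob P chk S2 * ((1 - p2) / p2) *
         Var (source_law P chk S2) (\<lambda>w. snd (\<rho> (Vobs chk w)) *\<^sub>R f (fst w))"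

text \<open>\<open>f X\<close> times the indicator of the event that \<open>V\<close> lies in \<open>S\<close>.\<close>

definition f_on :: "('x \<Rightarrow> 'c) \<Rightarrow> ('x \<Rightarrow> 'b::euclidean_space) \<Rightarrow> ('c \<times> 'u) set \<Rightarrow> 'x \<times> 'u \<Rightarrow> 'b" where
  "f_on chk f S w = indicator S (Vobs chk w) *\<^sub>R f (fst w)"

definition c_denom ::
    "('x \<times> 'u) measure \<Rightarrow> ('x \<Rightarrow> 'c) \<Rightarrow> ('c \<times> 'u) set \<Rightarrow> ('c \<times> 'u) set \<Rightarrow>
     real \<Rightarrow> real \<Rightarrow> ('x \<Rightarrow> 'b::euclidean_space) \<Rightarrow> real" where
  "c_denom P chk S1 S2 p1 p2 f =
     (let Z = f_on chk f (S1 \<inter> S2) in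
      source_prob P chk S1 * od p1 * Var (source_law P chk S1) Z
      + source_prob P chk S2 * od p2 * Var (source_law P chk S2) Z)"

text \<open>
  This formula corrects the published one, whose numerator has the opposite overall sign and
  which uses \<open>Y1\<close> in place of \<open>Y2\<close> in the second source, where \<open>Y1\<close> vanishes identically.
  With either misprint the resulting weight is not a minimizer in general.  For instance, take
  \<open>S1 = S2\<close> equal to the whole space, \<open>p1 = p2 = 1/2\<close> and \<open>f X\<close> uniform on \<open>{-1, 1}\<close>.  The
  asymptotic variance with overlap weights \<open>(c, 1 - c)\<close> is then \<open>1 + c\<^sup>2 + (1 - c)\<^sup>2\<close>, with
  minimizer \<open>c = 1/2\<close>, whereas the published formula gives \<open>-1/2\<close>, truncated to \<open>0\<close>.

  Products of means are inner products, which are ordinary products for \<open>k = 1\<close>.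
\<close>

definition c_opt ::
    "('x \<times> 'u) measure \<Rightarrow> ('x \<Rightarrow> 'c) \<Rightarrow> ('c \<times> 'u) set \<Rightarrow> ('c \<times> 'u) set \<Rightarrow>
     real \<Rightarrow> real \<Rightarrow> ('x \<Rightarrow> 'b::euclidean_space) \<Rightarrow> real" where
  "c_opt P chk S1 S2 p1 p2 f =
     (let \<nu>1 = source_prob P chk S1; \<nu>2 = source_prob P chk S2;
          P1 = source_law P chk S1; P2 = source_law P chk S2;
          Y1 = f_on chk f (S1 - S2); Y2 = f_on chk f (S2 - S1); Z = f_on chk f (S1 \<inter> S2)
      in (\<nu>1 * od p1 * ((\<integral>w. Y1 w \<partial>P1) \<bullet> (\<integral>w. Z w \<partial>P1))
          - \<nu>2 * od p2 * ((\<integral>w. Y2 w \<partial>P2) \<bullet> (\<integral>w. Z w \<partial>P2) - Var P2 Z))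
         / c_denom P chk S1 S2 p1 p2 f)"

end

theory Submission
  imports Defs
begin

text \<open>
  On each source the weighted variable is \<open>Y + c *\<^sub>R Z\<close> with \<open>Y\<close>, \<open>Z\<close> supported on disjoint
  events, so the covariance of \<open>Y\<close> and \<open>Z\<close> is minus the product of their means, and the
  asymptotic variance is a quadratic \<open>K - 2 N c + D c\<^sup>2\<close> in the overlap weight \<open>c\<close>, with
  \<open>N / D\<close> as stated.  If \<open>D = 0\<close>, nonnegativity of the variances forces \<open>N = 0\<close>, so every
  weight is optimal.
\<close>

text \<open>With vertex \<open>m = N / D\<close>, the right side minus the left side is
  \<open>2 * D * (c - m) * (x - c)\<close>. Since \<open>c\<close> is the point of [0,1] nearest to
  \<open>m\<close>, the two factors never have opposite signs. The surplus
  \<open>D * (x - c)\<^sup>2\<close> on the left is kept because it later yields uniqueness of the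
  minimizer.\<close>

lemma quadratic_le_at_clipped_vertex:
  fixes D N c x :: real
  assumes "0 \<le> D" and "D = 0 \<Longrightarrow> N = 0" and "c = max 0 (min (N / D) 1)" and "x \<in> {0..1}"
  shows "D * c\<^sup>2 - 2 * N * c + D * (x - c)\<^sup>2 \<le> D * x\<^sup>2 - 2 * N * x"
proof (cases "D = 0")
  case False
  then have D: "0 < D"
    using assms(1) by simp
  have "0 \<le> (c - N / D) * (x - c)"
  proof -
    consider "N / D < 0" | "N / D > 1" | "0 \<le> N / D" "N / D \<le> 1"
      by linarith
    then show ?thesis
    proof cases
      case 1
      then show ?thesis
        using assms(3,4) by (intro mult_nonneg_nonneg) auto
    next
      case 2
      then show ?thesis
        using assms(3,4) by (intro mult_nonpos_nonpos) auto
    next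
      case 3
      then show ?thesis
        using assms(3) by simp
    qed
  qed
  then have "0 \<le> 2 * (D * ((c - N / D) * (x - c)))"
    using D by simp
  also have "\<dots> = 2 * (D * c - N) * (x - c)"
    using D by (simp add: field_simps)
  also have "\<dots> = (D * x\<^sup>2 - 2 * N * x) - (D * c\<^sup>2 - 2 * N * c + D * (x - c)\<^sup>2)"
    by (simp add: power2_eq_square algebra_simps)
  finally show ?thesis
    by simp
qed (use assms(2) in simp)

lemma Var_nonneg: "0 \<le> Var Q Y"
  by (simp add: Var_def)

lemma (in prob_space) Var_eq:
  fixes Y :: "'a \<Rightarrow> 'b::euclidean_space"
  assumes [measurable]: "Y \<in> borel_measurable M" and [simp]: "integrable M (\<lambda>w. (norm (Y w))\<^sup>2)"
  shows "Var M Y = (\<integral>w. (norm (Y w))\<^sup>2 \<partial>M) - (norm (\<integral>w. Y w \<partial>M))\<^sup>2"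
proof -
  have "integrable M (\<lambda>w. norm (Y w))"
    by (rule square_integrable_imp_integrable) simp_all
  then have [simp]: "integrable M Y"
    by (simp add: integrable_norm_iff)
  define m where "m = (\<integral>w. Y w \<partial>M)"
  have "Var M Y = (\<integral>w. (norm (Y w))\<^sup>2 - 2 * (Y w \<bullet> m) + (norm m)\<^sup>2 \<partial>M)"
    unfolding Var_def m_def[symmetric]
    by (intro Bochner_Integration.integral_cong refl)
       (simp add: power2_norm_eq_inner inner_diff inner_commute)
  also have "\<dots> = (\<integral>w. (norm (Y w))\<^sup>2 \<partial>M) - 2 * (m \<bullet> m) + (norm m)\<^sup>2"
    by (simp add: m_def prob_space)
  finally show ?thesis
    by (simp add: m_def power2_norm_eq_inner)
qed

text \<open>Pointwise orthogonality removes the mixed second moment, so only the squared norm of the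
  mean contributes a cross term. It serves the first source with \<open>c = x\<close> and the second
  with \<open>c = 1 - x\<close>.\<close>

lemma (in prob_space) Var_add_scaleR:
  fixes Y Z :: "'a \<Rightarrow> 'b::euclidean_space"
  assumes [measurable]: "Y \<in> borel_measurable M" "Z \<in> borel_measurable M"
    and [simp]: "integrable M (\<lambda>w. (norm (Y w))\<^sup>2)" "integrable M (\<lambda>w. (norm (Z w))\<^sup>2)"
    and disj: "\<And>w. Y w \<bullet> Z w = 0"
  shows "Var M (\<lambda>w. Y w + c *\<^sub>R Z w)
    = Var M Y - 2 * c * ((\<integral>w. Y w \<partial>M) \<bullet> (\<integral>w. Z w \<partial>M)) + c\<^sup>2 * Var M Z"
proof -
  have "integrable M (\<lambda>w. norm (Y w))" "integrable M (\<lambda>w. norm (Z w))"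
    by (rule square_integrable_imp_integrable; simp)+
  then have [simp]: "integrable M Y" "integrable M Z"
    by (simp_all add: integrable_norm_iff)
  have expand: "(norm (u + c *\<^sub>R v))\<^sup>2 = (norm u)\<^sup>2 + 2 * c * (u \<bullet> v) + c\<^sup>2 * (norm v)\<^sup>2"
    for u v :: 'b
    unfolding power2_norm_eq_inner
    by (simp add: inner_add inner_commute power2_eq_square algebra_simps)
  show ?thesis
    by (simp add: Var_eq expand disj algebra_simps)
qed

text \<open>The variance of \<open>Y + c *\<^sub>R Z\<close> would be negative for some \<open>c\<close> otherwise.\<close>

lemma (in prob_space) inner_means_eq_0_if_Var_eq_0:
  fixes Y Z :: "'a \<Rightarrow> 'b::euclidean_space"
  assumes "Y \<in> borel_measurable M" "Z \<in> borel_measurable M"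
    and "integrable M (\<lambda>w. (norm (Y w))\<^sup>2)" "integrable M (\<lambda>w. (norm (Z w))\<^sup>2)"
    and "\<And>w. Y w \<bullet> Z w = 0" and "Var M Z = 0"
  shows "(\<integral>w. Y w \<partial>M) \<bullet> (\<integral>w. Z w \<partial>M) = 0"
proof (rule ccontr)
  let ?e = "(\<integral>w. Y w \<partial>M) \<bullet> (\<integral>w. Z w \<partial>M)"
  assume e: "?e \<noteq> 0"
  \<comment> \<open>The multiplier is chosen so that the right side collapses to
    \<open>- Var M Y - 2\<close>, which is negative.\<close>
  have "0 \<le> Var M Y - 2 * ((Var M Y + 1) / ?e) * ?e"
    using Var_add_scaleR[OF assms(1-5), of "(Var M Y + 1) / ?e"] assms(6)
      Var_nonneg[of M "\<lambda>w. Y w + ((Var M Y + 1) / ?e) *\<^sub>R Z w"]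
    by simp
  then show False
    using e Var_nonneg[of M Y] by simp
qed

text \<open>Conditioning on \<open>A\<close> has density \<open>indicator A x / measure M A\<close>,
  so integrability reduces to that of a constant multiple of \<open>g\<close> restricted to
  \<open>A\<close>.\<close>

lemma integrable_uniform_measure:
  fixes g :: "'a \<Rightarrow> 'b::{banach, second_countable_topology}"
  assumes [measurable]: "A \<in> sets M" and pos: "0 < measure M A" and g: "integrable M g"
  shows "integrable (uniform_measure M A) g"
proof -
  \<comment> \<open>\<open>M\<close> may be infinite, but \<open>measure\<close> assigns 0 to sets
    of infinite measure, so positivity of \<open>measure M A\<close> already makes \<open>A\<close>
    finite.\<close>
  have fin: "emeasure M A = ennreal (measure M A)"
    using pos by (intro emeasure_eq_ennreal_measure) (auto simp: measure_def)
  have "indicator A x / emeasure M A = ennreal (indicator A x / measure M A)" for x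
    unfolding fin using pos by (cases "x \<in> A") (simp_all add: divide_ennreal flip: ennreal_1)
  then have "uniform_measure M A = density M (\<lambda>x. ennreal (indicator A x / measure M A))"
    by (simp add: uniform_measure_def)
  moreover have "integrable M (\<lambda>x. (indicator A x / measure M A) *\<^sub>R g x)"
    using integrable_scaleR_right[OF integrable_mult_indicator[OF assms(1) g],
        of "1 / measure M A"] by simp
  ultimately show ?thesis
    using pos g by (simp add: integrable_density)
qed

text \<open>These facts supply what the variance expansion requires under a conditional law. The
  conditioning source \<open>S\<close> and the restricting set \<open>T\<close> are kept separate,
  so that one source can treat both its exclusive part and the overlap. Square integrability passes
  from \<open>f\<close> to \<open>f_on chk f T\<close> by domination, then to the conditional law
  because \<open>S\<close> has positive probability.\<close>

lemma source_law_moments: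
  fixes f :: "'x \<Rightarrow> 'b::euclidean_space" and P :: "('x \<times> 'u) measure"
  assumes P: "prob_space P" "sets P = sets (MX \<Otimes>\<^sub>M MU)"
    and chk: "chk \<in> MX \<rightarrow>\<^sub>M MC"
    and S: "S \<in> sets (MC \<Otimes>\<^sub>M MU)" "0 < source_prob P chk S"
    and T: "T \<in> sets (MC \<Otimes>\<^sub>M MU)"
    and f: "f \<in> borel_measurable MX" "integrable (distr P MX fst) (\<lambda>x. (norm (f x))\<^sup>2)"
  shows "prob_space (source_law P chk S)"
    and "f_on chk f T \<in> borel_measurable (source_law P chk S)"
    and "integrable (source_law P chk S) (\<lambda>w. (norm (f_on chk f T w))\<^sup>2)"
proof -
  interpret prob_space P
    by (rule P)
  note [measurable_cong] = P(2)
  note [measurable] = chk S(1) T f(1)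
  have V [measurable]: "Vobs chk \<in> P \<rightarrow>\<^sub>M MC \<Otimes>\<^sub>M MU"
    unfolding Vobs_def by measurable
  have A [measurable]: "in_source P chk S \<in> sets P"
    unfolding in_source_def by measurable
  show "prob_space (source_law P chk S)"
    unfolding source_law_def using S(2)
    by (intro prob_space_uniform_measure) (auto simp: source_prob_def emeasure_eq_measure)
  have m [measurable]: "f_on chk f T \<in> borel_measurable P"
    unfolding f_on_def by measurable
  then show "f_on chk f T \<in> borel_measurable (source_law P chk S)"
    by (simp add: source_law_def)
  have "integrable P (\<lambda>w. (norm (f (fst w)))\<^sup>2)"
    using f(2) by (subst (asm) integrable_distr_eq) auto
  then have "integrable P (\<lambda>w. (norm (f_on chk f T w))\<^sup>2)"
    by (rule Bochner_Integration.integrable_bound) (auto simp: f_on_def indicator_def)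
  then show "integrable (source_law P chk S) (\<lambda>w. (norm (f_on chk f T w))\<^sup>2)"
    unfolding source_law_def using S(2)
    by (intro integrable_uniform_measure) (auto simp: source_prob_def)
qed

theorem proposition3p2:
  fixes MX :: "'x measure" and MU :: "'u measure" and MC :: "'c measure"
    and P :: "('x \<times> 'u) measure" and chk :: "'x \<Rightarrow> 'c"
    and S1 S2 :: "('c \<times> 'u) set" and p1 p2 :: real
    and f :: "'x \<Rightarrow> 'b::euclidean_space"
  assumes "prob_space P" and "sets P = sets (MX \<Otimes>\<^sub>M MU)"
    and "chk \<in> MX \<rightarrow>\<^sub>M MC"
    and "S1 \<in> sets (MC \<Otimes>\<^sub>M MU)" and "S2 \<in> sets (MC \<Otimes>\<^sub>M MU)"
    and "S1 \<union> S2 = space (MC \<Otimes>\<^sub>M MU)" and "S1 \<inter> S2 \<noteq> {}"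
    and "0 < source_prob P chk S1" and "0 < source_prob P chk S2"
    and "0 < p1" and "p1 \<le> 1" and "0 < p2" and "p2 \<le> 1"
    and "f \<in> borel_measurable MX"
    and "integrable (distr P MX fst) (\<lambda>x. (norm (f x))\<^sup>2)"
  shows "let c = max 0 (min (c_opt P chk S1 S2 p1 p2 f) 1);
             optimal = is_arg_min (asymp_var MX P chk S1 S2 p1 p2 f)
                         (\<lambda>\<rho>. \<rho> \<in> weight_functions S1 S2)
         in optimal (weight_with S1 S2 c (1 - c)) \<and>
            (c_denom P chk S1 S2 p1 p2 f \<noteq> 0 \<longrightarrow>
               (\<forall>\<rho>. optimal \<rho> \<longrightarrow> (\<forall>v \<in> S1 \<inter> S2. \<rho> v = (c, 1 - c))))"
proof -
  define a where "a = source_prob P chk S1 * od p1"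
  define b where "b = source_prob P chk S2 * od p2"
  define Q1 where "Q1 = source_law P chk S1"
  define Q2 where "Q2 = source_law P chk S2"
  define Y1 where "Y1 = f_on chk f (S1 - S2)"
  define Y2 where "Y2 = f_on chk f (S2 - S1)"
  define Z where "Z = f_on chk f (S1 \<inter> S2)"
  define e1 where "e1 = (\<integral>w. Y1 w \<partial>Q1) \<bullet> (\<integral>w. Z w \<partial>Q1)"
  define e2 where "e2 = (\<integral>w. Y2 w \<partial>Q2) \<bullet> (\<integral>w. Z w \<partial>Q2)"
  define D where "D = a * Var Q1 Z + b * Var Q2 Z"
  define N where "N = a * e1 - b * (e2 - Var Q2 Z)"
  \<comment> \<open>The second source carries weight \<open>1 - x\<close> on the overlap. Expanding
    its variance in powers of \<open>x\<close> puts \<open>- 2 * e2 + Var Q2 Z\<close> into the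
    constant term and \<open>- b * (e2 - Var Q2 Z)\<close> into \<open>N\<close>.\<close>
  define K where "K = Var (distr P MX fst) f + a * Var Q1 Y1 + b * (Var Q2 Y2 - 2 * e2 + Var Q2 Z)"
  \<comment> \<open>If \<open>D = 0\<close>, division by zero gives \<open>N / D = 0\<close> and
    hence \<open>c = 0\<close>. This is still a minimizer, since \<open>N\<close> vanishes too and
    the objective is constant.\<close>
  define c where "c = max 0 (min (N / D) 1)"
  note defs = a_def b_def Q1_def Q2_def Y1_def Y2_def Z_def
  have c_opt: "c_opt P chk S1 S2 p1 p2 f = N / D" and c_denom: "c_denom P chk S1 S2 p1 p2 f = D"
    by (simp_all add: c_opt_def c_denom_def N_def D_def e1_def e2_def Let_def defs)
  have [simp]: "0 \<le> a" "0 \<le> b"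
    using assms by (simp_all add: a_def b_def od_def)

  have sets: "S1 - S2 \<in> sets (MC \<Otimes>\<^sub>M MU)" "S2 - S1 \<in> sets (MC \<Otimes>\<^sub>M MU)"
      "S1 \<inter> S2 \<in> sets (MC \<Otimes>\<^sub>M MU)"
    using assms(4,5) by auto
  note mom1 = source_law_moments[OF assms(1-4,8) _ assms(14,15), folded Q1_def]
  note mom2 = source_law_moments[OF assms(1-3,5,9) _ assms(14,15), folded Q2_def]
  interpret Q1: prob_space Q1 by (rule mom1(1)[OF sets(3)])
  interpret Q2: prob_space Q2 by (rule mom2(1)[OF sets(3)])
  have orth: "Y1 w \<bullet> Z w = 0" "Y2 w \<bullet> Z w = 0" for w
    by (auto simp: Y1_def Y2_def Z_def f_on_def indicator_def)
  note moms1 = mom1(2)[OF sets(1), folded Y1_def] mom1(2)[OF sets(3), folded Z_def]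
    mom1(3)[OF sets(1), folded Y1_def] mom1(3)[OF sets(3), folded Z_def] orth(1)
  note moms2 = mom2(2)[OF sets(2), folded Y2_def] mom2(2)[OF sets(3), folded Z_def]
    mom2(3)[OF sets(2), folded Y2_def] mom2(3)[OF sets(3), folded Z_def] orth(2)
  note var1 = Q1.Var_add_scaleR[OF moms1, folded e1_def]
  note var2 = Q2.Var_add_scaleR[OF moms2, folded e2_def]

  have D_nonneg: "0 \<le> D"
    by (simp add: D_def Var_nonneg)
  have N_0: "N = 0" if "D = 0"
  proof -
    have aV: "a * Var Q1 Z = 0" and bV: "b * Var Q2 Z = 0"
      using that by (simp_all add: D_def Var_nonneg add_nonneg_eq_0_iff)
    \<comment> \<open>Either \<open>a = 0\<close>, as under complete sampling with
      \<open>p1 = 1\<close>, or \<open>Var Q1 Z = 0\<close> and the inner product of the means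
      vanishes. The second source is analogous.\<close>
    have "a * e1 = 0"
      using aV Q1.inner_means_eq_0_if_Var_eq_0[OF moms1] by (auto simp: e1_def)
    moreover have "b * e2 = 0"
      using bV Q2.inner_means_eq_0_if_Var_eq_0[OF moms2] by (auto simp: e2_def)
    ultimately show ?thesis
      using bV unfolding N_def right_diff_distrib by linarith
  qed
  note le = quadratic_le_at_clipped_vertex[OF D_nonneg N_0 c_def]

  have Var_cong: "Var Q g = Var Q h" if "\<And>w. w \<in> space Q \<Longrightarrow> g w = h w"
    for Q :: "('x \<times> 'u) measure" and g h :: "'x \<times> 'u \<Rightarrow> 'b"
    unfolding Var_def using that by (simp cong: Bochner_Integration.integral_cong)
  have asymp: "asymp_var MX P chk S1 S2 p1 p2 f \<rho> = K + D * x\<^sup>2 - 2 * N * x"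
    if "\<forall>v \<in> S1 - S2. \<rho> v = (1, 0)" "\<forall>v \<in> S2 - S1. \<rho> v = (0, 1)"
      "\<forall>v \<in> S1 \<inter> S2. \<rho> v = (x, 1 - x)" for \<rho> x
  proof -
    have V: "Vobs chk w \<in> S1 \<union> S2" if "w \<in> space P" for w
      using that sets_eq_imp_space_eq[OF assms(2)] measurable_space[OF assms(3)]
      unfolding assms(6) by (auto simp: Vobs_def space_pair_measure)
    \<comment> \<open>The identities are proved on all of \<open>space P\<close> because
      \<open>source_law\<close> keeps the whole space and only changes the measure. As
      \<open>S1\<close> and \<open>S2\<close> cover all values of \<open>V\<close>, one of the three
      prescribed weights always applies; outside its own source a weight is 0, and so are the
      matching \<open>Y1\<close> or \<open>Y2\<close> and \<open>Z\<close>.\<close>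
    have *: "fst (\<rho> (Vobs chk w)) *\<^sub>R f (fst w) = Y1 w + x *\<^sub>R Z w"
      "snd (\<rho> (Vobs chk w)) *\<^sub>R f (fst w) = Y2 w + (1 - x) *\<^sub>R Z w" if "w \<in> space P" for w
      using V[OF that] \<open>\<forall>v \<in> S1 - S2. _ v\<close> \<open>\<forall>v \<in> S2 - S1. _ v\<close> \<open>\<forall>v \<in> S1 \<inter> S2. _ v\<close>
      by (auto simp: Y1_def Y2_def Z_def f_on_def indicator_def)
    have "Var Q1 (\<lambda>w. fst (\<rho> (Vobs chk w)) *\<^sub>R f (fst w)) = Var Q1 (\<lambda>w. Y1 w + x *\<^sub>R Z w)"
      "Var Q2 (\<lambda>w. snd (\<rho> (Vobs chk w)) *\<^sub>R f (fst w)) = Var Q2 (\<lambda>w. Y2 w + (1 - x) *\<^sub>R Z w)"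
      by (rule Var_cong; simp add: * Q1_def Q2_def source_law_def)+
    then have "asymp_var MX P chk S1 S2 p1 p2 f \<rho> = Var (distr P MX fst) f
        + a * Var Q1 (\<lambda>w. Y1 w + x *\<^sub>R Z w) + b * Var Q2 (\<lambda>w. Y2 w + (1 - x) *\<^sub>R Z w)"
      by (simp add: asymp_var_def a_def b_def od_def Q1_def Q2_def)
    then show ?thesis
      unfolding var1 var2 by (simp add: K_def D_def N_def power2_eq_square algebra_simps)
  qed
  have weight: "\<exists>x \<in> {0..1}. (\<forall>v \<in> S1 \<inter> S2. \<rho> v = (x, 1 - x)) \<and>
      asymp_var MX P chk S1 S2 p1 p2 f \<rho> = K + D * x\<^sup>2 - 2 * N * x"
    if "\<rho> \<in> weight_functions S1 S2" for \<rho>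
  proof -
    obtain x y where xy: "x \<in> {0..1}" "x + y = 1" "\<forall>v \<in> S1 - S2. \<rho> v = (1, 0)"
      "\<forall>v \<in> S2 - S1. \<rho> v = (0, 1)" "\<forall>v \<in> S1 \<inter> S2. \<rho> v = (x, y)"
      using \<open>\<rho> \<in> _\<close> unfolding weight_functions_def by auto
    have "y = 1 - x"
      using xy(2) by simp
    then show ?thesis
      using xy asymp[of \<rho> x] by auto
  qed
  have c01: "c \<in> {0..1}"
    by (simp add: c_def)
  have mem: "weight_with S1 S2 c (1 - c) \<in> weight_functions S1 S2"
    unfolding weight_functions_def mem_Collect_eq using c01
    by (intro exI[of _ c] exI[of _ "1 - c"]) (simp add: weight_with_def)
  have val: "asymp_var MX P chk S1 S2 p1 p2 f (weight_with S1 S2 c (1 - c)) = K + D * c\<^sup>2 - 2 * N * c"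
    by (rule asymp) (auto simp: weight_with_def)
  have opt: "is_arg_min (asymp_var MX P chk S1 S2 p1 p2 f) (\<lambda>\<rho>. \<rho> \<in> weight_functions S1 S2)
      (weight_with S1 S2 c (1 - c))"
    unfolding is_arg_min_linorder
  proof (intro conjI allI impI mem)
    fix \<rho> assume "\<rho> \<in> weight_functions S1 S2"
    then obtain x where x: "x \<in> {0..1}"
      "asymp_var MX P chk S1 S2 p1 p2 f \<rho> = K + D * x\<^sup>2 - 2 * N * x"
      using weight by blast
    \<comment> \<open>For optimality it suffices to drop the nonnegative surplus in
      \<open>le\<close>.\<close>
    have "0 \<le> D * (x - c)\<^sup>2"
      using D_nonneg by simp
    then show "asymp_var MX P chk S1 S2 p1 p2 f (weight_with S1 S2 c (1 - c))
        \<le> asymp_var MX P chk S1 S2 p1 p2 f \<rho>"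
      using le[OF _ x(1)] unfolding val x(2) by simp
  qed
  have uniq: "\<forall>v \<in> S1 \<inter> S2. \<rho> v = (c, 1 - c)"
    if D: "D \<noteq> 0" and \<rho>: "is_arg_min (asymp_var MX P chk S1 S2 p1 p2 f)
      (\<lambda>\<rho>. \<rho> \<in> weight_functions S1 S2) \<rho>" for \<rho>
  proof -
    obtain x where x: "x \<in> {0..1}" "\<forall>v \<in> S1 \<inter> S2. \<rho> v = (x, 1 - x)"
      "asymp_var MX P chk S1 S2 p1 p2 f \<rho> = K + D * x\<^sup>2 - 2 * N * x"
      using weight \<rho> unfolding is_arg_min_def by blast
    have "K + D * x\<^sup>2 - 2 * N * x \<le> K + D * c\<^sup>2 - 2 * N * c"
      using \<rho> mem unfolding is_arg_min_linorder val[symmetric] x(3)[symmetric] by blast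
    \<comment> \<open>A minimizer does no worse than the clipped weight, whereas \<open>le\<close>
      says that it does worse by at least the surplus. Hence the surplus vanishes, and
      \<open>D > 0\<close> forces \<open>x = c\<close>.\<close>
    then have "D * (x - c)\<^sup>2 \<le> 0"
      using le[OF _ x(1)] by simp
    then have "x = c"
      using D D_nonneg by (simp add: mult_le_0_iff)
    then show ?thesis
      using x(2) by simp
  qed
  show ?thesis
    using opt uniq by (simp add: Let_def c_opt c_denom flip: c_def)
qed

end
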